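(* Let $C\subset\mathbb{R}^m$ be a closed convex cone, let $A_1,\dots,A_n,B\in\mathbb{R}^m$ and $c\in\mathbb{R}^n$. Consider the primal program $$(P)\quad \min\Big\{\sum_{i=1}^n c_i x_i:\ \sum_{i=1}^n A_i x_i-B\in C,\ x\in\mathbb{R}^n\Big\}$$ and the dual program $$(D)\quad \max\big\{B\cdot Y:\ A_i\cdot Y=c_i\ \forall i\in\{1,\dots,n\},\ Y\in C^*\big\}.$$ If $(P)$ is bounded and has a strictly feasible solution, then the optimal values of $(P)$ and $(D)$ are equal and $(D)$ reaches this value (there is a feasible $Y$ of $(D)$ whose objective value $B\cdot Y$ equals the optimal value of $(P)$). If $(P)$ is unbounded, then $(D)$ is infeasible.
   Context: A convex cone is a (non-empty) set closed under linear combinations with positive coefficients. The dual cone is $C^*=\{Y\in\mathbb{R}^m:\ X\cdot Y\ge 0\ \forall X\in C\}$, where $\cdot$ is the standard scalar product. The optimal value of $(P)$ is the infimum of the objective over feasible points (not necessarily attained) and that of $(D)$ is the supremum. "$(P)$ is bounded" means its infimum is not $-\infty$; "unbounded" means the infimum is $-\infty$. A strictly feasible solution of $(P)$ is an $x\in\mathbb{R}^n$ such that $\sum_{i=1}^n A_ix_i-B$ lies in the (topological) interior of $C$ in $\mathbb{R}^m$. *)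

theory Defs
  imports "HOL-Analysis.Analysis"
begin

text \<open>The library predicate \<open>convex_cone\<close> also requires \<open>0\<close> to be a member. For closed sets this
  is the same as being non-empty and closed under linear combinations with positive coefficients
  (binary combinations suffice: \<open>a *\<^sub>R x\<close> with \<open>a > 0\<close> is the case \<open>y = x\<close> with coefficients
  \<open>a / 2\<close>, and longer ones are iterated).\<close>

lemma closed_convex_cone_iff_positive_combinations:
  fixes C :: "'a::real_normed_vector set"
  assumes "closed C"
  shows "convex_cone C \<longleftrightarrow>
    C \<noteq> {} \<and> (\<forall>x\<in>C. \<forall>y\<in>C. \<forall>a>0. \<forall>b>0. a *\<^sub>R x + b *\<^sub>R y \<in> C)"
proof
  assume "convex_cone C"
  then show "C \<noteq> {} \<and> (\<forall>x\<in>C. \<forall>y\<in>C. \<forall>a>0. \<forall>b>0. a *\<^sub>R x + b *\<^sub>R y \<in> C)"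
    by (simp add: convex_cone_nonempty convex_cone_add convex_cone_scaleR)
next
  assume *: "C \<noteq> {} \<and> (\<forall>x\<in>C. \<forall>y\<in>C. \<forall>a>0. \<forall>b>0. a *\<^sub>R x + b *\<^sub>R y \<in> C)"
  have scale: "a *\<^sub>R x \<in> C" if "x \<in> C" "a > 0" for a x
  proof -
    have "(a/2) *\<^sub>R x + (a/2) *\<^sub>R x \<in> C"
      using *[THEN conjunct2, rule_format, of x x "a/2" "a/2"] that by simp
    then show ?thesis
      by (simp only: scaleR_add_left[symmetric] field_sum_of_halves)
  qed
  have add: "x + y \<in> C" if "x \<in> C" "y \<in> C" for x y
  proof -
    have "1 *\<^sub>R x + 1 *\<^sub>R y \<in> C"
      using *[THEN conjunct2, rule_format, of x y 1 1] that by simp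
    then show ?thesis by simp
  qed
  obtain x where "x \<in> C"
    using * by blast
  have "(\<lambda>k. inverse (real (Suc k)) *\<^sub>R x) \<longlonglongrightarrow> 0 *\<^sub>R x"
    by (intro tendsto_scaleR LIMSEQ_inverse_real_of_nat tendsto_const)
  moreover have "inverse (real (Suc k)) *\<^sub>R x \<in> C" for k
    using \<open>x \<in> C\<close> by (intro scale) auto
  ultimately have "0 *\<^sub>R x \<in> C"
    using closed_sequentially[OF assms] by fast
  then have zero: "0 \<in> C"
    by simp
  have nonneg: "a *\<^sub>R x \<in> C" if "x \<in> C" "a \<ge> 0" for a x
    using scale[OF that(1)] that(2) zero by (cases "a = 0") auto
  show "convex_cone C"
    unfolding convex_cone_iff by (intro conjI ballI allI impI zero add nonneg)
qed

definition dual_cone :: "(real ^ 'm) set \<Rightarrow> (real ^ 'm) set" where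
  "dual_cone C = {Y. \<forall>X\<in>C. X \<bullet> Y \<ge> 0}"

definition primal_slack :: "('n::finite \<Rightarrow> real ^ 'm) \<Rightarrow> real ^ 'm \<Rightarrow> real ^ 'n \<Rightarrow> real ^ 'm" where
  "primal_slack A B x = (\<Sum>i\<in>UNIV. x $ i *\<^sub>R A i) - B"

definition primal_feasible ::
    "(real ^ 'm) set \<Rightarrow> ('n::finite \<Rightarrow> real ^ 'm) \<Rightarrow> real ^ 'm \<Rightarrow> (real ^ 'n) set" where
  "primal_feasible C A B = {x. primal_slack A B x \<in> C}"

definition primal_strictly_feasible ::
    "(real ^ 'm) set \<Rightarrow> ('n::finite \<Rightarrow> real ^ 'm) \<Rightarrow> real ^ 'm \<Rightarrow> (real ^ 'n) set" where
  "primal_strictly_feasible C A B = {x. primal_slack A B x \<in> interior C}"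

definition dual_feasible ::
    "(real ^ 'm) set \<Rightarrow> ('n::finite \<Rightarrow> real ^ 'm) \<Rightarrow> real ^ 'n \<Rightarrow> (real ^ 'm) set" where
  "dual_feasible C A c = {Y. (\<forall>i. A i \<bullet> Y = c $ i) \<and> Y \<in> dual_cone C}"

text \<open>Optimal values are extended reals: an infeasible minimisation problem has value \<open>\<infinity>\<close>, an
  infeasible maximisation problem \<open>-\<infinity>\<close>.\<close>

definition primal_value ::
    "(real ^ 'm) set \<Rightarrow> ('n::finite \<Rightarrow> real ^ 'm) \<Rightarrow> real ^ 'm \<Rightarrow> real ^ 'n \<Rightarrow> ereal" where
  "primal_value C A B c = (INF x\<in>primal_feasible C A B. ereal (\<Sum>i\<in>UNIV. c $ i * x $ i))"

definition dual_value ::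
    "(real ^ 'm) set \<Rightarrow> ('n::finite \<Rightarrow> real ^ 'm) \<Rightarrow> real ^ 'm \<Rightarrow> real ^ 'n \<Rightarrow> ereal" where
  "dual_value C A B c = (SUP Y\<in>dual_feasible C A c. ereal (B \<bullet> Y))"

definition primal_bounded ::
    "(real ^ 'm) set \<Rightarrow> ('n::finite \<Rightarrow> real ^ 'm) \<Rightarrow> real ^ 'm \<Rightarrow> real ^ 'n \<Rightarrow> bool" where
  "primal_bounded C A B c \<longleftrightarrow> primal_value C A B c \<noteq> -\<infinity>"

end

theory Submission
  imports Defs
begin

text \<open>Weak duality is a direct computation. For strong duality, let \<open>p\<close> be the primal value. The
  affine set of all pairs \<open>(\<Sum>i. x\<^sub>i A\<^sub>i - B, c \<bullet> x)\<close> is disjoint from the convex set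
  \<open>interior C \<times> {..<p}\<close>, so a hyperplane with normal \<open>(Y, q)\<close> separates the two. An affine function
  that is bounded above is constant, which gives \<open>A\<^sub>i \<bullet> Y = - q c\<^sub>i\<close>; strict feasibility forces \<open>q < 0\<close>,
  and \<open>- Y / q\<close> is then a dual solution of value at least \<open>p\<close>.\<close>

lemma primal_slack_inner:
  "primal_slack A B x \<bullet> Y = (\<Sum>i\<in>UNIV. x $ i * (A i \<bullet> Y)) - B \<bullet> Y"
  by (simp add: primal_slack_def inner_diff_left inner_sum_left)

lemma weak_duality:
  assumes "x \<in> primal_feasible C A B" "Y \<in> dual_feasible C A c"
  shows "B \<bullet> Y \<le> (\<Sum>i\<in>UNIV. c $ i * x $ i)"
proof -
  have "0 \<le> primal_slack A B x \<bullet> Y"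
    using assms by (auto simp: primal_feasible_def dual_feasible_def dual_cone_def)
  then show ?thesis
    using assms by (simp add: primal_slack_inner dual_feasible_def mult.commute)
qed

lemma dual_le_primal_value:
  assumes "Y \<in> dual_feasible C A c"
  shows "ereal (B \<bullet> Y) \<le> primal_value C A B c"
  unfolding primal_value_def using weak_duality[OF _ assms] by (auto intro!: INF_greatest)

text \<open>The image of \<open>interior C\<close> under scaling by \<open>s\<close> is open and
  lies in \<open>C\<close>, hence lies in the interior.\<close>

lemma interior_cone_scaleR:
  fixes C :: "'a::euclidean_space set"
  assumes "convex_cone C" "U \<in> interior C" "s > 0"
  shows "s *\<^sub>R U \<in> interior C"
proof -
  have "(*\<^sub>R) s ` interior C \<subseteq> C"
    using convex_cone_scaleR[OF assms(1)] assms(3) interior_subset[of C] by force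
  moreover have "open ((*\<^sub>R) s ` interior C)"
    using assms(3) by (intro open_scaling) auto
  ultimately show ?thesis
    using assms(2) interior_maximal by blast
qed

lemma nonneg_slope_if_bounded_below:
  fixes a b e :: real
  assumes "\<And>s. s > 0 \<Longrightarrow> b \<le> s * a + e"
  shows "a \<ge> 0"
proof (rule ccontr)
  assume "\<not> a \<ge> 0"
  \<comment> \<open>Chosen so that \<open>s * a + e = e - \<bar>b - e\<bar> - 1\<close>, which is
    below \<open>b\<close>.\<close>
  define s where "s = (\<bar>b - e\<bar> + 1) / (- a)"
  have "s > 0"
    using \<open>\<not> a \<ge> 0\<close> unfolding s_def by (intro divide_pos_pos) auto
  moreover have "s * a = - (\<bar>b - e\<bar> + 1)"
    using \<open>\<not> a \<ge> 0\<close> by (simp add: s_def)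
  ultimately show False
    using assms[of s] by linarith
qed

lemma zero_slope_if_bounded_above:
  fixes a b e :: real
  assumes "\<And>s. s * a + e \<le> b"
  shows "a = 0"
proof -
  have "a \<ge> 0"
  proof (rule nonneg_slope_if_bounded_below)
    show "e \<le> s * a + b" for s
      using assms[of "- s"] by simp
  qed
  moreover have "- a \<ge> 0"
  proof (rule nonneg_slope_if_bounded_below)
    show "e \<le> s * - a + b" for s
      using assms[of s] by simp
  qed
  ultimately show ?thesis
    by simp
qed

text \<open>A short step from \<open>U\<close> against \<open>Y\<close> stays in the open set and
  strictly lowers the inner product unless \<open>Y\<close> vanishes. This later excludes a vertical
  hyperplane, that is, \<open>q = 0\<close>.\<close>

lemma inner_min_on_open_imp_zero:
  fixes Y :: "'a::real_inner"
  assumes "open S" "U \<in> S" "\<And>V. V \<in> S \<Longrightarrow> U \<bullet> Y \<le> V \<bullet> Y"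
  shows "Y = 0"
proof (rule ccontr)
  assume "Y \<noteq> 0"
  obtain e where e: "e > 0" "ball U e \<subseteq> S"
    using assms(1,2) open_contains_ball by blast
  define V where "V = U - (e / (2 * norm Y)) *\<^sub>R Y"
  have "V \<in> S"
    using e \<open>Y \<noteq> 0\<close> by (intro subsetD[OF e(2)]) (simp add: V_def dist_norm)
  then have "e / (2 * norm Y) * (Y \<bullet> Y) \<le> 0"
    using assms(3)[of V] by (simp add: V_def inner_diff_left)
  moreover have "e / (2 * norm Y) * (Y \<bullet> Y) > 0"
    using e \<open>Y \<noteq> 0\<close> by (intro mult_pos_pos) auto
  ultimately show False
    by linarith
qed

lemma primal_slack_convex_comb:
  assumes "u + v = 1"
  shows "primal_slack A B (u *\<^sub>R x + v *\<^sub>R y)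
    = u *\<^sub>R primal_slack A B x + v *\<^sub>R primal_slack A B y"
proof -
  have "B = u *\<^sub>R B + v *\<^sub>R B"
    using assms by (metis scaleR_add_left scaleR_one)
  then show ?thesis
    by (simp add: primal_slack_def scaleR_add_left sum.distrib scaleR_sum_right
        scaleR_diff_right algebra_simps)
qed

lemma strong_duality:
  fixes C :: "(real ^ 'm) set" and A :: "'n::finite \<Rightarrow> real ^ 'm"
  assumes cone: "convex_cone C"
    and x0: "x0 \<in> primal_strictly_feasible C A B"
    and p: "primal_value C A B c = ereal p"
  shows "\<exists>Y\<in>dual_feasible C A c. B \<bullet> Y = p"
proof -
  define f where "f x = (\<Sum>i\<in>UNIV. c $ i * x $ i)" for x :: "real ^ 'n"
  define U0 where "U0 = primal_slack A B x0"
  have U0: "U0 \<in> interior C"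
    using x0 by (simp add: primal_strictly_feasible_def U0_def)
  have convC: "convex C"
    using cone by (simp add: convex_cone_def)
  have p_le: "p \<le> f x" if "primal_slack A B x \<in> C" for x
  proof -
    have "primal_value C A B c \<le> ereal (f x)"
      unfolding primal_value_def f_def using that by (intro INF_lower) (simp add: primal_feasible_def)
    then show ?thesis by (simp add: p)
  qed
  let ?S = "range (\<lambda>x. (primal_slack A B x, f x))"
  let ?T = "interior C \<times> {..<p}"
  have "convex ?S"
  proof (rule convexI)
    fix a b :: "(real ^ 'm) \<times> real" and u v :: real
    assume "a \<in> ?S" "b \<in> ?S" and uv: "u \<ge> 0" "v \<ge> 0" "u + v = 1"
    then obtain x y where xy: "a = (primal_slack A B x, f x)" "b = (primal_slack A B y, f y)"
      by blast
    have "f (u *\<^sub>R x + v *\<^sub>R y) = u * f x + v * f y"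
      by (simp add: f_def sum_distrib_left sum.distrib algebra_simps)
    then have "u *\<^sub>R a + v *\<^sub>R b
        = (primal_slack A B (u *\<^sub>R x + v *\<^sub>R y), f (u *\<^sub>R x + v *\<^sub>R y))"
      using uv xy by (simp add: primal_slack_convex_comb)
    then show "u *\<^sub>R a + v *\<^sub>R b \<in> ?S" by blast
  qed
  moreover have "convex ?T"
    using convC by (intro convex_Times convex_interior) auto
  \<comment> \<open>A common point would come from a feasible \<open>x\<close> with objective below
    the primal value.\<close>
  moreover have "?S \<inter> ?T = {}"
    using p_le interior_subset by fastforce
  moreover have "(U0, p - 1) \<in> ?T"
    using U0 by simp
  then have "?T \<noteq> {}" by blast
  ultimately obtain w b where w: "w \<noteq> 0" "\<forall>z\<in>?S. w \<bullet> z \<le> b" "\<forall>z\<in>?T. w \<bullet> z \<ge> b"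
    using separating_hyperplane_sets[of ?S ?T] by blast
  obtain Y q where wYq: "w = (Y, q)" by (cases w)
  have S: "primal_slack A B x \<bullet> Y + q * f x \<le> b" for x
    using w(2) by (auto simp: wYq inner_commute)
  have T: "b \<le> U \<bullet> Y + q * t" if "U \<in> interior C" "t < p" for U t
    using w(3)[rule_format, of "(U, t)"] that by (simp add: wYq inner_commute[of Y])
  \<comment> \<open>At fixed \<open>U0\<close> the second coordinate \<open>p - s\<close> may tend
    to minus infinity while the lower bound \<open>b\<close> persists.\<close>
  have "- q \<ge> 0"
  proof (rule nonneg_slope_if_bounded_below)
    show "b \<le> s * - q + (U0 \<bullet> Y + q * p)" if "s > 0" for s
      using T[OF U0, of "p - s"] that by (simp add: algebra_simps)
  qed
  \<comment> \<open>Along coordinate axis \<open>i\<close> the left side of \<open>S\<close> is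
    affine in \<open>s\<close> and bounded above on the whole line, so its slope vanishes.\<close>
  have AY: "A i \<bullet> Y + q * c $ i = 0" for i
  proof (rule zero_slope_if_bounded_above)
    fix s
    have "primal_slack A B (axis i s) \<bullet> Y = s * (A i \<bullet> Y) - B \<bullet> Y"
      by (simp add: primal_slack_inner axis_def if_distrib[of "\<lambda>u. u * _"] cong: if_cong)
    moreover have "f (axis i s) = c $ i * s"
      by (simp add: f_def axis_def if_distrib[of "\<lambda>u. _ * u"] cong: if_cong)
    ultimately show "s * (A i \<bullet> Y + q * c $ i) + (- (B \<bullet> Y)) \<le> b"
      using S[of "axis i s"] by (simp add: algebra_simps)
  qed
  have BY: "- (B \<bullet> Y) \<le> b"
    using S[of 0] by (simp add: primal_slack_inner f_def)
  \<comment> \<open>With \<open>q = 0\<close>, \<open>S\<close> at \<open>x0\<close> and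
    \<open>T\<close> make \<open>U0\<close> a minimiser of the inner product with \<open>Y\<close>
    over \<open>interior C\<close>; then \<open>Y = 0\<close>, contradicting
    \<open>w \<noteq> 0\<close>.\<close>
  have "q \<noteq> 0"
  proof
    assume q: "q = 0"
    have "U0 \<bullet> Y \<le> V \<bullet> Y" if "V \<in> interior C" for V
      using S[of x0] T[OF that, of "p - 1"] by (simp add: q U0_def)
    then have "Y = 0"
      using U0 inner_min_on_open_imp_zero[OF open_interior] by blast
    then show False
      using w(1) by (simp add: wYq q zero_prod_def)
  qed
  then have q: "q < 0"
    using \<open>- q \<ge> 0\<close> by simp
  \<comment> \<open>Dividing by \<open>- q > 0\<close> normalises the equations \<open>AY\<close> to
    those of the dual program and keeps the sign needed for the dual cone.\<close>
  define Z where "Z = (- 1 / q) *\<^sub>R Y"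
  \<comment> \<open>Scaling \<open>U\<close> by arbitrarily large \<open>s\<close> stays in
    \<open>interior C\<close>, so a negative inner product would break the lower bound
    \<open>b\<close>.\<close>
  have "U \<bullet> Y \<ge> 0" if "U \<in> interior C" for U
  proof (rule nonneg_slope_if_bounded_below)
    show "b \<le> s * (U \<bullet> Y) + q * (p - 1)" if "s > 0" for s
      using T[OF interior_cone_scaleR[OF cone \<open>U \<in> interior C\<close> that], of "p - 1"] by simp
  qed
  then have "interior C \<subseteq> {U. U \<bullet> Y \<ge> 0}" by blast
  then have "closure (interior C) \<subseteq> {U. U \<bullet> Y \<ge> 0}"
    by (rule closure_minimal) (intro closed_Collect_le continuous_intros)
  \<comment> \<open>The point \<open>U0\<close> makes the interior nonempty, so the convex set
    \<open>C\<close> lies in the closure of its interior.\<close>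
  then have "C \<subseteq> {U. U \<bullet> Y \<ge> 0}"
    using convex_closure_interior[OF convC] U0 closure_subset[of C] by blast
  then have "Z \<in> dual_cone C"
    using q by (auto simp: dual_cone_def Z_def divide_nonneg_neg mult_nonneg_nonpos)
  moreover have "A i \<bullet> Z = c $ i" for i
    using AY[of i] q by (simp add: Z_def field_simps)
  ultimately have Z: "Z \<in> dual_feasible C A c"
    by (simp add: dual_feasible_def)
  \<comment> \<open>The point \<open>(0, p)\<close> lies outside \<open>?T\<close> but is the limit
    of its points \<open>(e *\<^sub>R U0, p - e)\<close> as \<open>e\<close> decreases to 0, so the
    bound passes to it.\<close>
  have "b \<le> q * p"
  proof -
    have "((\<lambda>e. (e *\<^sub>R U0) \<bullet> Y + q * (p - e)) \<longlongrightarrow> (0 *\<^sub>R U0) \<bullet> Y + q * (p - 0)) (at_right 0)"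
      by (intro tendsto_intros)
    moreover have "\<forall>\<^sub>F e in at_right 0. b \<le> (e *\<^sub>R U0) \<bullet> Y + q * (p - e)"
      using eventually_at_right_less[of 0]
      by eventually_elim (intro T interior_cone_scaleR[OF cone U0], auto)
    ultimately have "b \<le> (0 *\<^sub>R U0) \<bullet> Y + q * (p - 0)"
      by (intro tendsto_lowerbound[where F = "at_right 0"]) auto
    then show ?thesis by simp
  qed
  then have "- (B \<bullet> Y) \<le> q * p"
    using BY by simp
  then have "p \<le> B \<bullet> Z"
    using q by (simp add: Z_def field_simps)
  moreover have "B \<bullet> Z \<le> p"
    using dual_le_primal_value[OF Z, of B] by (simp add: p)
  ultimately show ?thesis
    using Z by force
qed

theorem theorem5:
  fixes C :: "(real ^ 'm) set"
    and A :: "'n::finite \<Rightarrow> real ^ 'm"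
    and B :: "real ^ 'm"
    and c :: "real ^ 'n"
  assumes "closed C" and "convex_cone C"
  shows "(primal_bounded C A B c \<and> primal_strictly_feasible C A B \<noteq> {} \<longrightarrow>
            primal_value C A B c = dual_value C A B c \<and>
            (\<exists>Y\<in>dual_feasible C A c. ereal (B \<bullet> Y) = primal_value C A B c))
       \<and> (\<not> primal_bounded C A B c \<longrightarrow> dual_feasible C A c = {})"
proof (intro conjI impI)
  assume "\<not> primal_bounded C A B c"
  \<comment> \<open>A dual feasible \<open>Y\<close> would bound the primal value below by a real
    number, ruling out minus infinity.\<close>
  then show "dual_feasible C A c = {}"
    using dual_le_primal_value[of _ C A c B] by (fastforce simp: primal_bounded_def)
next
  assume *: "primal_bounded C A B c \<and> primal_strictly_feasible C A B \<noteq> {}"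
  then obtain x0 where x0: "x0 \<in> primal_strictly_feasible C A B" by blast
  then have "x0 \<in> primal_feasible C A B"
    using interior_subset by (auto simp: primal_strictly_feasible_def primal_feasible_def)
  then have "primal_value C A B c \<le> ereal (\<Sum>i\<in>UNIV. c $ i * x0 $ i)"
    unfolding primal_value_def by (rule INF_lower)
  \<comment> \<open>Boundedness excludes minus infinity and the feasible \<open>x0\<close> excludes
    plus infinity.\<close>
  then obtain p where p: "primal_value C A B c = ereal p"
    using * by (cases "primal_value C A B c") (auto simp: primal_bounded_def)
  obtain Y where Y: "Y \<in> dual_feasible C A c" "B \<bullet> Y = p"
    using strong_duality[OF assms(2) x0 p] by blast
  then show "\<exists>Y\<in>dual_feasible C A c. ereal (B \<bullet> Y) = primal_value C A B c"
    by (auto simp: p)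
  have "dual_value C A B c \<le> primal_value C A B c"
    unfolding dual_value_def by (intro SUP_least dual_le_primal_value)
  moreover have "ereal (B \<bullet> Y) \<le> dual_value C A B c"
    unfolding dual_value_def using Y(1) by (rule SUP_upper)
  ultimately show "primal_value C A B c = dual_value C A B c"
    using Y(2) p by auto
qed

end
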